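(* Let $H$ be an arbitrary fixed hypergraph (with nonempty vertex set). Let $\mathbf{p}=(p_r)_{r\ge 1}$ be any sequence such that $0\le p_r=p_r(n)\le 1$ for each $r\ge 1$, and let $\mathcal{J}$ denote the family of all strong subgraphs of $H$. For a hypergraph $H'$ write $$\mu_s(H') = n^{v(H')}\prod_{r\ge 1} p_r^{e_r(H')}.$$ \begin{itemize} \item[(a)] If for some $H'\in\mathcal{J}$ we have $\mu_s(H')\to 0$ as $n\to\infty$, then a.a.s. $\mathscr{H}(n,\mathbf{p})$ does not contain $H$ as a strong subgraph. \item[(b)] If for all $H'\in\mathcal{J}$ we have $\mu_s(H')\to\infty$ as $n\to\infty$, then a.a.s. $\mathscr{H}(n,\mathbf{p})$ contains $H$ as a strong subgraph. \end{itemize} Moreover, if there exists a constant $\varepsilon>0$ such that $p_r\le 1-\varepsilon$ for all $r$, then the same conditions determine whether $H$ appears as an induced strong subgraph: under the hypothesis of (a), a.a.s. $\mathscr{H}(n,\mathbf{p})$ contains no induced strong copy of $H$, and under the hypothesis of (b), a.a.s. it contains an induced strong copy of $H$.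
   Context: A hypergraph is a pair $H=(V,E)$ with $V$ a finite set and $E$ a family of subsets of $V$ (hyperedges, or edges). $v(H)=|V|$, and $e_r(H)$ is the number of edges of $H$ of size $r$. Convention: $0^0=1$. The random hypergraph $\mathscr{H}(n,\mathbf{p})$ has vertex set $[n]=\{1,\dots,n\}$, and every subset $e\subseteq[n]$ with $|e|=r$ is chosen to be an edge independently with probability $p_r$ (for all $r\ge1$, all choices independent). A hypergraph $H'=(V',E')$ is a strong subgraph (strong subhypergraph) of $H=(V,E)$ if $V'\subseteq V$ and $E'\subseteq E$. For $V'\subseteq V$, the strong subgraph induced by $V'$ has vertex set $V'$ and edge set $\{e\in E: e\subseteq V'\}$. "$\mathscr{H}(n,\mathbf{p})$ contains $H$ as a strong subgraph" means it has a strong subgraph isomorphic to $H$ (a strong copy); an induced strong copy is an induced strong subgraph isomorphic to $H$. All asymptotics are as $n\to\infty$; an event holds asymptotically almost surely (a.a.s.) if its probability tends to $1$ as $n\to\infty$.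
   Formalization: The hypergraph H is assumed to have no empty edge (the random model has none, so (b) would fail), and the family J is taken to consist of the strong subgraphs with nonempty vertex set (otherwise the hypothesis of (b) could never hold). *)

theory Defs
  imports "HOL-Probability.Probability"
begin

type_synonym 'a hypergraph = "'a set \<times> 'a set set"

abbreviation verts :: "'a hypergraph \<Rightarrow> 'a set" where
  "verts H \<equiv> fst H"

abbreviation edges :: "'a hypergraph \<Rightarrow> 'a set set" where
  "edges H \<equiv> snd H"

definition hypergraph :: "'a hypergraph \<Rightarrow> bool" where
  "hypergraph H \<longleftrightarrow> finite (verts H) \<and> edges H \<subseteq> Pow (verts H)"

definition num_edges :: "nat \<Rightarrow> 'a hypergraph \<Rightarrow> nat" where
  "num_edges r H = card {e \<in> edges H. card e = r}"

definition strong_subgraph :: "'a hypergraph \<Rightarrow> 'a hypergraph \<Rightarrow> bool" where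
  "strong_subgraph H' H \<longleftrightarrow>
     hypergraph H' \<and> verts H' \<subseteq> verts H \<and> edges H' \<subseteq> edges H"

(* The null hypergraph is left out: mu_s (defined below) is constantly 1 for it, so "mu_s of
   every strong subgraph tends to infinity" could otherwise never hold. *)
definition strong_subgraphs :: "'a hypergraph \<Rightarrow> 'a hypergraph set" where
  "strong_subgraphs H = {H'. strong_subgraph H' H \<and> verts H' \<noteq> {}}"

definition induced_strong_subgraph :: "'a hypergraph \<Rightarrow> 'a set \<Rightarrow> 'a hypergraph" where
  "induced_strong_subgraph H W = (W, {e \<in> edges H. e \<subseteq> W})"

definition hypergraph_iso :: "'a hypergraph \<Rightarrow> 'b hypergraph \<Rightarrow> bool" where
  "hypergraph_iso G H \<longleftrightarrow>
     (\<exists>f. bij_betw f (verts G) (verts H) \<and> (`) f ` edges G = edges H)"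

definition contains_strong :: "'a hypergraph \<Rightarrow> 'b hypergraph \<Rightarrow> bool" where
  "contains_strong G H \<longleftrightarrow> (\<exists>G'. strong_subgraph G' G \<and> hypergraph_iso G' H)"

definition contains_induced_strong :: "'a hypergraph \<Rightarrow> 'b hypergraph \<Rightarrow> bool" where
  "contains_induced_strong G H \<longleftrightarrow>
     (\<exists>W \<subseteq> verts G. hypergraph_iso (induced_strong_subgraph G W) H)"

(* The argument q is the sequence of edge probabilities (for one fixed n), indexed by edge
   size; only its values at sizes r >= 1 matter. *)
definition random_hypergraph :: "nat \<Rightarrow> (nat \<Rightarrow> real) \<Rightarrow> nat hypergraph pmf" where
  "random_hypergraph n q =
     map_pmf (\<lambda>X. ({1..n}, {e \<in> Pow {1..n} - {{}}. X e}))
       (Pi_pmf (Pow {1..n} - {{}}) False (\<lambda>e. bernoulli_pmf (q (card e))))"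

(* p r n is the probability p_r(n).  In a hypergraph no edge has more than card (verts H)
   vertices, so all factors of the product over r >= 1 beyond this bound equal 1. *)
definition mu_s :: "(nat \<Rightarrow> nat \<Rightarrow> real) \<Rightarrow> 'a hypergraph \<Rightarrow> nat \<Rightarrow> real" where
  "mu_s p H n =
     real n ^ card (verts H) * (\<Prod>r = 1..card (verts H). p r n ^ num_edges r H)"

definition aas :: "(nat \<Rightarrow> 'b pmf) \<Rightarrow> ('b \<Rightarrow> bool) \<Rightarrow> bool" where
  "aas M Q \<longleftrightarrow> (\<lambda>n. measure_pmf.prob (M n) {x. Q x}) \<longlonglongrightarrow> 1"

end

theory Submission
  imports Defs
begin

text \<open>
  For (a), the expected number of copies of a subgraph \<open>H'\<close> is at most its \<open>\<mu>\<^sub>s\<close>, and a copy of \<open>H\<close>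
  contains one of \<open>H'\<close>.  For (b), split \<open>[n]\<close> into blocks of \<open>m = n div v(H)\<close> points, one for each
  vertex of \<open>H\<close>, and count only the copies that put every vertex into its own block.  Two such copies
  meet exactly in the image of the set \<open>W\<close> of vertices on which they agree, so the second moment method
  bounds the failure probability by the sum of \<open>1 / (m^|W| Q(W))\<close> over nonempty \<open>W\<close>, where \<open>Q(W)\<close> is
  the probability of the prescribed pattern inside \<open>W\<close>; each term is of order \<open>1 / \<mu>\<^sub>s(H[W])\<close>.
  Induced copies only differ by prescribing the non-edges as well, which costs a constant factor.
\<close>

section \<open>Prescribed coordinates, the second moment method and counting of maps\<close>

lemma prob_Pi_pmf_bernoulli:
  fixes q :: "'b \<Rightarrow> real"
  assumes A: "finite A" and ST: "S \<subseteq> A" "T \<subseteq> A" "S \<inter> T = {}"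
    and q: "\<And>x. x \<in> A \<Longrightarrow> 0 \<le> q x \<and> q x \<le> 1"
  shows "measure_pmf.prob (Pi_pmf A False (\<lambda>x. bernoulli_pmf (q x)))
           {X. (\<forall>x\<in>S. X x) \<and> (\<forall>x\<in>T. \<not> X x)} = (\<Prod>x\<in>S. q x) * (\<Prod>x\<in>T. 1 - q x)"
proof -
  \<comment> \<open>Prescribing coordinates makes the event a product set. Coordinates outside
    \<open>S\<close> and \<open>T\<close> get \<open>UNIV\<close> and contribute a factor 1.\<close>
  define B where "B x = (if x \<in> S then {True} else if x \<in> T then {False} else UNIV)" for x
  define f where "f x = measure_pmf.prob (bernoulli_pmf (q x)) (B x)" for x
  have "{X. (\<forall>x\<in>S. X x) \<and> (\<forall>x\<in>T. \<not> X x)} = Pi A B"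
    using ST by (fastforce simp: B_def Pi_def split: if_splits)
  then have "measure_pmf.prob (Pi_pmf A False (\<lambda>x. bernoulli_pmf (q x)))
      {X. (\<forall>x\<in>S. X x) \<and> (\<forall>x\<in>T. \<not> X x)} = prod f A"
    by (simp add: measure_Pi_pmf_Pi A f_def)
  also have "\<dots> = prod f (S \<union> T)"
    using A ST by (intro prod.mono_neutral_right) (auto simp: f_def B_def)
  also have "\<dots> = prod f S * prod f T"
    using A ST by (intro prod.union_disjoint) (auto dest: finite_subset)
  also have "prod f S = (\<Prod>x\<in>S. q x)"
    using ST q by (intro prod.cong) (auto simp: f_def B_def measure_pmf_single subset_iff)
  also have "prod f T = (\<Prod>x\<in>T. 1 - q x)"
    using ST q by (intro prod.cong) (auto simp: f_def B_def measure_pmf_single subset_iff)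
  finally show ?thesis .
qed

text \<open>Chebyshev's inequality for the number \<open>X\<close> of events \<open>F i\<close> that
  occur: its mean is \<open>s\<close>, and the double sum in the last hypothesis is its second
  moment, so its variance is at most \<open>\<delta> * s\<^sup>2\<close>.\<close>

lemma second_moment_union:
  fixes M :: "'b pmf" and F :: "'i \<Rightarrow> 'b set"
  assumes I: "finite I" and s: "s = (\<Sum>i\<in>I. measure_pmf.prob M (F i))" "s > 0"
    and le: "(\<Sum>i\<in>I. \<Sum>j\<in>I. measure_pmf.prob M (F i \<inter> F j)) \<le> (1 + \<delta>) * s\<^sup>2"
  shows "measure_pmf.prob M (\<Union>i\<in>I. F i) \<ge> 1 - \<delta>"
proof -
  define X :: "'b \<Rightarrow> real" where "X x = (\<Sum>i\<in>I. indicator (F i) x)" for x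
  have sq: "(X x)\<^sup>2 = (\<Sum>i\<in>I. \<Sum>j\<in>I. indicator (F i \<inter> F j) x)" for x
    by (simp add: X_def power2_eq_square sum_product indicator_inter_arith)
  have int: "integrable (measure_pmf M) (indicator A :: 'b \<Rightarrow> real)" for A
    by (simp add: measure_pmf.emeasure_eq_measure)
  have EX: "measure_pmf.expectation M X = s"
    by (simp add: X_def[abs_def] s int)
  have EX2: "measure_pmf.expectation M (\<lambda>x. (X x)\<^sup>2) \<le> (1 + \<delta>) * s\<^sup>2"
    using le by (simp add: sq int del: indicator_inter_arith)
  have iX: "integrable (measure_pmf M) X" "integrable (measure_pmf M) (\<lambda>x. (X x)\<^sup>2)"
    by (simp_all add: sq int) (simp add: X_def[abs_def] int)
  have V: "measure_pmf.variance M X \<le> \<delta> * s\<^sup>2"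
    using EX2 measure_pmf.variance_eq[OF iX] unfolding EX distrib_right by linarith
  have "1 - measure_pmf.prob M (\<Union>i\<in>I. F i) = measure_pmf.prob M (- (\<Union>i\<in>I. F i))"
    using measure_pmf.prob_compl[of "\<Union>i\<in>I. F i" M] by (simp add: Compl_eq_Diff_UNIV)
  \<comment> \<open>Outside the union \<open>X\<close> is 0, so it deviates from its mean by exactly
    \<open>s\<close>.\<close>
  also have "\<dots> \<le> measure_pmf.prob M {x \<in> space (measure_pmf M). s \<le> \<bar>X x - measure_pmf.expectation M X\<bar>}"
    using s by (intro measure_pmf.finite_measure_mono) (auto simp: EX, simp add: X_def)
  also have "\<dots> \<le> measure_pmf.variance M X / s\<^sup>2"
    by (intro measure_pmf.Chebyshev_inequality) (use iX s in auto)
  also have "\<dots> \<le> \<delta>"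
    using V s by (simp add: divide_simps)
  finally show ?thesis by simp
qed

text \<open>The values on \<open>W\<close> are forced and those on \<open>V - W\<close> are free,
  which leaves \<open>m ^ card (V - W)\<close> maps. The product form avoids subtraction in the
  exponent.\<close>

lemma card_PiE_agree:
  fixes m :: nat
  assumes V: "finite V" and W: "W \<subseteq> V" and a: "a \<in> PiE V (\<lambda>_. {..<m})"
  shows "card {b \<in> PiE V (\<lambda>_. {..<m}). \<forall>v\<in>W. b v = a v} * m ^ card W = m ^ card V"
proof -
  have "{b \<in> PiE V (\<lambda>_. {..<m}). \<forall>v\<in>W. b v = a v} = PiE V (\<lambda>v. if v \<in> W then {a v} else {..<m})"
    (is "?L = ?R")
  proof (intro equalityI subsetI)
    fix b assume "b \<in> ?L"
    then show "b \<in> ?R" by (auto simp: PiE_iff)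
  next
    fix b assume b: "b \<in> ?R"
    have "b v = a v" if "v \<in> W" for v
      using b W that by (auto simp: PiE_iff split: if_splits)
    moreover have "b v < m" if "v \<in> V" for v
      using b a that by (cases "v \<in> W") (auto simp: PiE_iff)
    ultimately show "b \<in> ?L" using b by (auto simp: PiE_iff)
  qed
  then have "card {b \<in> PiE V (\<lambda>_. {..<m}). \<forall>v\<in>W. b v = a v} = (\<Prod>v\<in>V. if v \<in> W then 1 else m)"
    using V by (simp add: card_PiE if_distrib[of card] cong: if_cong)
  also have "\<dots> = m ^ card (V - W)"
    using V by (subst prod.If_cases) (auto simp: Diff_eq)
  finally show ?thesis
    using V W by (simp add: card_Diff_subset finite_subset card_mono flip: power_add)
qed

section \<open>Edge indicators and copies placed block by block\<close>

text \<open>The family of edge indicators before it is packed into a hypergraph. Here the presence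
  of a given copy is a condition on finitely many coordinates, so its probability is a
  product.\<close>

definition random_edges :: "nat \<Rightarrow> (nat \<Rightarrow> real) \<Rightarrow> (nat set \<Rightarrow> bool) pmf" where
  "random_edges n q = Pi_pmf (Pow {1..n} - {{}}) False (\<lambda>e. bernoulli_pmf (q (card e)))"

definition edge_hypergraph :: "nat \<Rightarrow> (nat set \<Rightarrow> bool) \<Rightarrow> nat hypergraph" where
  "edge_hypergraph n X = ({1..n}, {e \<in> Pow {1..n} - {{}}. X e})"

lemma prob_random_hypergraph:
  "measure_pmf.prob (random_hypergraph n q) A =
   measure_pmf.prob (random_edges n q) (edge_hypergraph n -` A)"
  by (simp add: random_hypergraph_def random_edges_def edge_hypergraph_def[abs_def] measure_map_pmf)

text \<open>An injective \<open>f\<close> keeps the sizes of edges and sends distinct edges to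
  distinct edges, so a weight that depends on size only is preserved.\<close>

lemma prod_image_edges:
  assumes "finite V" "E \<subseteq> Pow V" "inj_on f V"
  shows "(\<Prod>e\<in>(`) f ` E. g (card e)) = (\<Prod>e\<in>E. g (card e))"
proof -
  have "inj_on ((`) f) E"
    using assms by (meson inj_on_image_Pow inj_on_subset)
  then have "(\<Prod>e\<in>(`) f ` E. g (card e)) = (\<Prod>e\<in>E. g (card (f ` e)))"
    by (simp add: prod.reindex)
  also have "\<dots> = (\<Prod>e\<in>E. g (card e))"
    using assms by (intro prod.cong refl) (metis PowD card_image inj_on_subset subsetD)
  finally show ?thesis .
qed

text \<open>The second moment bound at a fixed \<open>n\<close>. \<open>E\<close> holds the
  prescribed edges and \<open>D\<close> the prescribed non-edges, so one statement serves both plain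
  copies (\<open>D\<close> empty) and induced ones (\<open>D\<close> all nonempty
  non-edges).\<close>

lemma copy_prob_ge:
  fixes q :: "nat \<Rightarrow> real" and V :: "'a set"
  assumes V: "finite V" and ED: "E \<subseteq> Pow V - {{}}" "D \<subseteq> Pow V - {{}}" "E \<inter> D = {}"
    and q: "\<And>r. r \<ge> 1 \<Longrightarrow> 0 \<le> q r \<and> q r \<le> 1"
    and mn: "card V * m \<le> n" and m: "m > 0"
    and Q: "\<And>W. Q W = (\<Prod>e\<in>{e\<in>E. e \<subseteq> W}. q (card e)) * (\<Prod>e\<in>{e\<in>D. e \<subseteq> W}. 1 - q (card e))"
    and pos: "\<And>e. e \<in> E \<Longrightarrow> q (card e) > 0" "\<And>e. e \<in> D \<Longrightarrow> q (card e) < 1"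
  shows "measure_pmf.prob (random_edges n q)
           {X. \<exists>f. inj_on f V \<and> f ` V \<subseteq> {1..n} \<and> (\<forall>e\<in>E. X (f ` e)) \<and> (\<forall>e\<in>D. \<not> X (f ` e))}
         \<ge> 1 - (\<Sum>W\<in>Pow V - {{}}. 1 / (real m ^ card W * Q W))"
    (is "_ \<ge> 1 - ?\<delta>")
proof -
  obtain \<iota> where \<iota>: "bij_betw \<iota> V {..<card V}"
    using V by (metis ex_bij_betw_finite_nat atLeast0LessThan)
  define I where "I = PiE V (\<lambda>_. {..<m})"
  \<comment> \<open>Vertex \<open>v\<close> goes to position \<open>a v\<close> of block number
    \<open>\<iota> v\<close>; the shift by 1 is there because the random hypergraph lives on
    \<open>{1..n}\<close>.\<close>
  define f where "f a v = \<iota> v * m + a v + 1" for a v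
  define F where "F a = {X. (\<forall>e\<in>(`) (f a) ` E. X e) \<and> (\<forall>e\<in>(`) (f a) ` D. \<not> X e)}" for a
  \<comment> \<open>The agreement set of two placements; it governs how far their events depend on
    each other.\<close>
  define A where "A a b = {v \<in> V. a v = b v}" for a b :: "'a \<Rightarrow> nat"
  have finI: "finite I" and cardI: "card I = m ^ card V"
    using V by (simp_all add: I_def finite_PiE card_PiE)
  have finED: "finite E" "finite D"
    using ED V by (meson finite_Diff finite_Pow_iff finite_subset)+
  have f_eq: "u = v \<and> a u = b v" if "a \<in> I" "b \<in> I" "u \<in> V" "v \<in> V" "f a u = f b v" for a b u v
  proof -
    have lt: "a u < m" "b v < m" using that by (auto simp: I_def)
    \<comment> \<open>Since offsets are below \<open>m\<close>, division by \<open>m\<close>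
      recovers the block and hence the vertex.\<close>
    have "(\<iota> u * m + a u) div m = (\<iota> v * m + b v) div m" using that by (simp add: f_def)
    then have "\<iota> u = \<iota> v" using lt by simp
    then show ?thesis using that \<iota> by (auto simp: f_def bij_betw_def inj_on_def)
  qed
  have f_inj: "inj_on (f a) V" if "a \<in> I" for a
    using f_eq[OF that that] by (auto simp: inj_on_def)
  have f_range: "f a ` V \<subseteq> {1..n}" if "a \<in> I" for a
  proof
    fix x assume "x \<in> f a ` V"
    then obtain v where v: "v \<in> V" "x = f a v" by auto
    have "a v < m" "\<iota> v < card V" using v that \<iota> by (auto simp: I_def bij_betw_def)
    then have "f a v \<le> Suc (\<iota> v) * m" "Suc (\<iota> v) * m \<le> card V * m"
      by (auto simp: f_def intro!: mult_right_mono simp del: mult_Suc) simp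
    then show "x \<in> {1..n}" using mn v by (simp add: f_def)
  qed
  \<comment> \<open>As blocks are disjoint, two placements can only share the image of one and the
    same vertex set, and only if they agree on all of it.\<close>
  have image_eq: "e = e' \<and> e \<subseteq> A a b"
    if "a \<in> I" "b \<in> I" "e \<subseteq> V" "e' \<subseteq> V" "f a ` e = f b ` e'" for a b e e'
  proof -
    have "u \<in> e' \<and> a u = b u" if "u \<in> e" for u
    proof -
      have "f a u \<in> f b ` e'" using that \<open>f a ` e = f b ` e'\<close> by blast
      then obtain v where "v \<in> e'" "f a u = f b v" by blast
      then show ?thesis using f_eq[of a b u v] \<open>a \<in> I\<close> \<open>b \<in> I\<close> \<open>e \<subseteq> V\<close> \<open>e' \<subseteq> V\<close> that by auto
    qed
    moreover have "u \<in> e" if "u \<in> e'" for u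
    proof -
      have "f b u \<in> f a ` e" using that \<open>f a ` e = f b ` e'\<close> by blast
      then obtain v where "v \<in> e" "f a v = f b u" by (metis imageE)
      then show ?thesis using f_eq[of a b v u] \<open>a \<in> I\<close> \<open>b \<in> I\<close> \<open>e \<subseteq> V\<close> \<open>e' \<subseteq> V\<close> that by auto
    qed
    ultimately show ?thesis using \<open>e \<subseteq> V\<close> by (auto simp: A_def)
  qed
  have inter: "(`) (f a) ` K \<inter> (`) (f b) ` K = (`) (f a) ` {e\<in>K. e \<subseteq> A a b}"
    if "a \<in> I" "b \<in> I" "K \<subseteq> Pow V - {{}}" for a b K
  proof (intro equalityI subsetI)
    fix x assume "x \<in> (`) (f a) ` K \<inter> (`) (f b) ` K"
    then obtain e e' where e: "e \<in> K" "x = f a ` e" and e': "e' \<in> K" "x = f b ` e'"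
      by (elim IntE imageE) simp
    then have "e \<subseteq> A a b" using image_eq[of a b e e'] that by auto
    then show "x \<in> (`) (f a) ` {e\<in>K. e \<subseteq> A a b}" using e by simp
  next
    fix x assume "x \<in> (`) (f a) ` {e\<in>K. e \<subseteq> A a b}"
    then obtain e where e: "e \<in> K" "e \<subseteq> A a b" "x = f a ` e" by auto
    then have "x = f b ` e" by (auto simp: A_def f_def subset_iff intro!: image_cong)
    then show "x \<in> (`) (f a) ` K \<inter> (`) (f b) ` K"
      using e by (intro IntI image_eqI[where x = e]) auto
  qed
  \<comment> \<open>No set is required to be an edge by one placement and a non-edge by another, so
    the two events together still prescribe disjoint families of coordinates.\<close>
  have disj: "(`) (f a) ` E \<inter> (`) (f b) ` D = {}" if "a \<in> I" "b \<in> I" for a b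
  proof -
    have False if "d \<in> E" "e \<in> D" "f a ` d = f b ` e" for d e
    proof -
      have "d = e" using image_eq[of a b d e] \<open>a \<in> I\<close> \<open>b \<in> I\<close> ED(1,2) that by auto
      then show False using ED(3) that by auto
    qed
    then show ?thesis by (auto simp: image_iff)
  qed
  have img: "(`) (f a) ` K \<subseteq> Pow {1..n} - {{}}" if "a \<in> I" "K \<subseteq> Pow V - {{}}" for a K
  proof (rule image_subsetI)
    fix e assume "e \<in> K"
    then have "e \<subseteq> V" "e \<noteq> {}" using that(2) by auto
    then show "f a ` e \<in> Pow {1..n} - {{}}"
      using image_mono[OF \<open>e \<subseteq> V\<close>, of "f a"] f_range[OF that(1)] by auto
  qed
  have q1: "0 \<le> q (card e) \<and> q (card e) \<le> 1" if "e \<in> Pow {1..n} - {{}}" for e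
    using that q[of "card e"] by (metis DiffD1 DiffD2 One_nat_def PowD Suc_leI card_gt_0_iff
        finite_atLeastAtMost finite_subset insertI1 singletonI)
  have Qpos: "Q W > 0" for W
    unfolding Q using pos by (intro mult_pos_pos prod_pos) auto
  have QV: "Q V = (\<Prod>e\<in>E. q (card e)) * (\<Prod>e\<in>D. 1 - q (card e))"
  proof -
    have "{e\<in>E. e \<subseteq> V} = E" "{e\<in>D. e \<subseteq> V} = D" using ED by auto
    then show ?thesis by (simp add: Q)
  qed
  have PF: "measure_pmf.prob (random_edges n q) (F a) = Q V" if a: "a \<in> I" for a
  proof -
    have "measure_pmf.prob (random_edges n q) (F a) =
        (\<Prod>e\<in>(`) (f a) ` E. q (card e)) * (\<Prod>e\<in>(`) (f a) ` D. 1 - q (card e))"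
      unfolding random_edges_def F_def
      by (rule prob_Pi_pmf_bernoulli) (use img[OF a] ED disj[OF a a] q1 in auto)
    also have "\<dots> = Q V"
      using prod_image_edges[OF V _ f_inj[OF a], of E q] ED
        prod_image_edges[OF V _ f_inj[OF a], of D "\<lambda>r. 1 - q r"] by (simp add: QV Diff_subset_conv subset_Diff_insert)
    finally show ?thesis .
  qed
  have PFF: "measure_pmf.prob (random_edges n q) (F a \<inter> F b) = (Q V)\<^sup>2 / Q (A a b)"
    if a: "a \<in> I" and b: "b \<in> I" for a b
  proof -
    have sub: "E \<subseteq> Pow V" "D \<subseteq> Pow V" "{e\<in>E. e \<subseteq> A a b} \<subseteq> Pow V" "{e\<in>D. e \<subseteq> A a b} \<subseteq> Pow V"
      using ED by auto
    \<comment> \<open>Multiplicative inclusion-exclusion: the shared images occur once in the union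
      but twice in the product, and they are exactly the images of members of \<open>K\<close>
      inside the agreement set.\<close>
    have uni: "prod g ((`) (f a) ` K \<union> (`) (f b) ` K) * prod g ((`) (f a) ` {e\<in>K. e \<subseteq> A a b})
        = prod g ((`) (f a) ` K) * prod g ((`) (f b) ` K)"
      if "K \<subseteq> Pow V - {{}}" "finite K" for K and g :: "_ \<Rightarrow> real"
      using prod.union_inter[of "(`) (f a) ` K" "(`) (f b) ` K" g] inter[OF a b that(1)] that(2)
      by simp
    have "F a \<inter> F b = {X. (\<forall>e\<in>(`) (f a) ` E \<union> (`) (f b) ` E. X e) \<and>
                          (\<forall>e\<in>(`) (f a) ` D \<union> (`) (f b) ` D. \<not> X e)}"
      by (auto simp: F_def)
    then have "measure_pmf.prob (random_edges n q) (F a \<inter> F b) =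
        (\<Prod>e\<in>(`) (f a) ` E \<union> (`) (f b) ` E. q (card e)) *
        (\<Prod>e\<in>(`) (f a) ` D \<union> (`) (f b) ` D. 1 - q (card e))"
      unfolding random_edges_def
      apply (simp only:)
      apply (rule prob_Pi_pmf_bernoulli)
      using img[OF a ED(1)] img[OF b ED(1)] img[OF a ED(2)] img[OF b ED(2)]
        disj[OF a a] disj[OF a b] disj[OF b a] disj[OF b b] q1
      by (simp_all add: Int_Un_distrib Int_Un_distrib2)
    then have "measure_pmf.prob (random_edges n q) (F a \<inter> F b) * Q (A a b) =
        ((\<Prod>e\<in>(`) (f a) ` E \<union> (`) (f b) ` E. q (card e)) *
         (\<Prod>e\<in>(`) (f a) ` {e\<in>E. e \<subseteq> A a b}. q (card e))) *
        ((\<Prod>e\<in>(`) (f a) ` D \<union> (`) (f b) ` D. 1 - q (card e)) *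
         (\<Prod>e\<in>(`) (f a) ` {e\<in>D. e \<subseteq> A a b}. 1 - q (card e)))"
      using prod_image_edges[OF V sub(3) f_inj[OF a], of q]
        prod_image_edges[OF V sub(4) f_inj[OF a], of "\<lambda>r. 1 - q r"]
      by (simp add: Q mult_ac)
    also have "\<dots> = (Q V)\<^sup>2"
      unfolding uni[OF ED(1) finED(1)] uni[OF ED(2) finED(2)]
      using prod_image_edges[OF V sub(1) f_inj[OF a], of q]
        prod_image_edges[OF V sub(2) f_inj[OF a], of "\<lambda>r. 1 - q r"]
        prod_image_edges[OF V sub(1) f_inj[OF b], of q]
        prod_image_edges[OF V sub(2) f_inj[OF b], of "\<lambda>r. 1 - q r"]
      by (simp add: QV power2_eq_square mult_ac)
    finally show ?thesis using Qpos[of "A a b"] by (simp add: field_simps)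
  qed
  have row: "(\<Sum>b\<in>I. measure_pmf.prob (random_edges n q) (F a \<inter> F b))
      \<le> real m ^ card V * (Q V)\<^sup>2 * (1 + ?\<delta>)" if a: "a \<in> I" for a
  proof -
    have "(\<Sum>b\<in>I. measure_pmf.prob (random_edges n q) (F a \<inter> F b)) = (\<Sum>b\<in>I. (Q V)\<^sup>2 / Q (A a b))"
      using a by (intro sum.cong) (auto simp: PFF)
    \<comment> \<open>The maps \<open>b\<close> are sorted by their agreement set \<open>W\<close>
      with \<open>a\<close>. Relaxing agreement exactly on \<open>W\<close> to agreement at least on
      \<open>W\<close> then bounds the size of each class.\<close>
    also have "\<dots> = (\<Sum>W\<in>Pow V. \<Sum>b\<in>{b\<in>I. A a b = W}. (Q V)\<^sup>2 / Q (A a b))"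
      by (rule sum.group[symmetric]) (auto simp: finI V A_def)
    also have "\<dots> = (\<Sum>W\<in>Pow V. real (card {b\<in>I. A a b = W}) * ((Q V)\<^sup>2 / Q W))"
      by (intro sum.cong refl) simp
    also have "\<dots> \<le> (\<Sum>W\<in>Pow V. real m ^ card V / real m ^ card W * ((Q V)\<^sup>2 / Q W))"
    proof (intro sum_mono mult_right_mono)
      fix W assume W: "W \<in> Pow V"
      have "card {b\<in>I. A a b = W} \<le> card {b\<in>I. \<forall>v\<in>W. b v = a v}"
        using finI by (intro card_mono) (auto simp: A_def)
      then have "card {b\<in>I. A a b = W} * m ^ card W
          \<le> card {b\<in>I. \<forall>v\<in>W. b v = a v} * m ^ card W"
        by (rule mult_right_mono) simp
      also have "\<dots> = m ^ card V"
        using card_PiE_agree[OF V, of W a m] W a unfolding I_def by blast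
      finally have "card {b\<in>I. A a b = W} * m ^ card W \<le> m ^ card V" .
      then have "real (card {b\<in>I. A a b = W}) * real m ^ card W \<le> real m ^ card V"
        by (metis of_nat_le_iff of_nat_mult of_nat_power)
      then show "real (card {b\<in>I. A a b = W}) \<le> real m ^ card V / real m ^ card W"
        using m by (simp add: field_simps)
    qed (use Qpos in \<open>auto intro!: divide_nonneg_pos\<close>)
    also have "\<dots> = real m ^ card V * (Q V)\<^sup>2 * (\<Sum>W\<in>Pow V. 1 / (real m ^ card W * Q W))"
      by (simp add: sum_distrib_left)
    \<comment> \<open>The term of the empty \<open>W\<close> is 1, which gives the main term
      \<open>s\<^sup>2\<close> of the second moment; the remaining terms are the error.\<close>
    also have "(\<Sum>W\<in>Pow V. 1 / (real m ^ card W * Q W)) = 1 + ?\<delta>"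
    proof -
      have "{e\<in>E. e \<subseteq> {}} = {}" "{e\<in>D. e \<subseteq> {}} = {}" using ED by auto
      then have "Q {} = 1" unfolding Q by (simp only: prod.empty mult_1)
      then show ?thesis using V by (subst sum.remove[of _ "{}"]) auto
    qed
    finally show ?thesis .
  qed
  have "1 - ?\<delta> \<le> measure_pmf.prob (random_edges n q) (\<Union>a\<in>I. F a)"
  proof (rule second_moment_union[OF finI refl])
    have s: "(\<Sum>a\<in>I. measure_pmf.prob (random_edges n q) (F a)) = real m ^ card V * Q V"
      by (simp add: PF cardI)
    show "(\<Sum>a\<in>I. measure_pmf.prob (random_edges n q) (F a)) > 0"
      using m Qpos by (simp add: s)
    have "(\<Sum>a\<in>I. \<Sum>b\<in>I. measure_pmf.prob (random_edges n q) (F a \<inter> F b))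
        \<le> (\<Sum>a\<in>I. real m ^ card V * (Q V)\<^sup>2 * (1 + ?\<delta>))"
      by (intro sum_mono row)
    also have "\<dots> = (1 + ?\<delta>) * (real m ^ card V * Q V)\<^sup>2"
      by (simp add: cardI power2_eq_square)
    finally show "(\<Sum>a\<in>I. \<Sum>b\<in>I. measure_pmf.prob (random_edges n q) (F a \<inter> F b))
        \<le> (1 + ?\<delta>) * (\<Sum>a\<in>I. measure_pmf.prob (random_edges n q) (F a))\<^sup>2"
      by (simp only: s)
  qed
  also have "\<dots> \<le> measure_pmf.prob (random_edges n q)
     {X. \<exists>f. inj_on f V \<and> f ` V \<subseteq> {1..n} \<and> (\<forall>e\<in>E. X (f ` e)) \<and> (\<forall>e\<in>D. \<not> X (f ` e))}"
  proof (rule measure_pmf.finite_measure_mono)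
    show "(\<Union>a\<in>I. F a) \<subseteq> {X. \<exists>f. inj_on f V \<and> f ` V \<subseteq> {1..n} \<and>
        (\<forall>e\<in>E. X (f ` e)) \<and> (\<forall>e\<in>D. \<not> X (f ` e))}"
    proof (intro UN_least subsetI CollectI)
      fix a X assume "a \<in> I" "X \<in> F a"
      then show "\<exists>f. inj_on f V \<and> f ` V \<subseteq> {1..n} \<and> (\<forall>e\<in>E. X (f ` e)) \<and> (\<forall>e\<in>D. \<not> X (f ` e))"
        using f_inj f_range by (intro exI[of _ "f a"]) (simp add: F_def)
    qed
  qed simp
  finally show ?thesis .
qed

section \<open>From the fixed-size bound to the limit, in terms of \<open>mu_s\<close>\<close>

text \<open>Grouping the edges by size; excluding the empty edge puts every size in the range
  \<open>1..card (verts H)\<close>.\<close>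

lemma mu_s_eq_prod:
  assumes "hypergraph H" "{} \<notin> edges H"
  shows "mu_s p H n = real n ^ card (verts H) * (\<Prod>e\<in>edges H. p (card e) n)"
proof -
  have fin: "finite (verts H)" "edges H \<subseteq> Pow (verts H)" "finite (edges H)"
    using assms by (auto simp: hypergraph_def finite_subset)
  have "card e \<in> {1..card (verts H)}" if "e \<in> edges H" for e
    using that fin assms(2)
    by (metis One_nat_def PowD Suc_leI atLeastAtMost_iff card_gt_0_iff card_mono finite_subset subsetD)
  then have "(\<Prod>r\<in>{1..card (verts H)}. \<Prod>e\<in>{e\<in>edges H. card e = r}. p (card e) n)
      = (\<Prod>e\<in>edges H. p (card e) n)"
    using fin by (intro prod.group) auto
  then show ?thesis by (simp add: mu_s_def num_edges_def)
qed

text \<open>Every error term of \<open>copy_prob_ge\<close> is at most a constant over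
  \<open>mu_s\<close> of the subgraph induced by \<open>W\<close>. There are finitely many such
  \<open>W\<close>, and each of these quotients tends to 0.\<close>

lemma copy_prob_tendsto_1:
  fixes H :: "'a hypergraph" and p :: "nat \<Rightarrow> nat \<Rightarrow> real"
  assumes H: "hypergraph H" "verts H \<noteq> {}" "{} \<notin> edges H"
    and p: "\<And>r n. r \<ge> 1 \<Longrightarrow> n \<ge> 1 \<Longrightarrow> 0 \<le> p r n \<and> p r n \<le> 1"
    and mu: "\<And>H'. H' \<in> strong_subgraphs H \<Longrightarrow> filterlim (mu_s p H') at_top sequentially"
    and D: "D \<subseteq> Pow (verts H) - {{}}" "edges H \<inter> D = {}"
    and \<epsilon>: "\<epsilon> > 0" "\<And>e n. e \<in> D \<Longrightarrow> n \<ge> 1 \<Longrightarrow> p (card e) n \<le> 1 - \<epsilon>"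
  shows "(\<lambda>n. measure_pmf.prob (random_edges n (\<lambda>r. p r n))
           {X. \<exists>f. inj_on f (verts H) \<and> f ` verts H \<subseteq> {1..n} \<and>
                   (\<forall>e\<in>edges H. X (f ` e)) \<and> (\<forall>e\<in>D. \<not> X (f ` e))}) \<longlonglongrightarrow> 1"
    (is "?P \<longlonglongrightarrow> 1")
proof -
  define V E k where "V = verts H" and "E = edges H" and "k = card V"
  have V: "finite V" "V \<noteq> {}" "E \<subseteq> Pow V - {{}}" and k: "k > 0"
    using H by (auto simp: hypergraph_def V_def E_def k_def card_gt_0_iff)
  have finE: "finite E" and finD: "finite D"
    using V D by (metis V_def finite_Diff finite_Pow_iff finite_subset)+
  define H' where "H' W = (W, {e\<in>E. e \<subseteq> W})" for W
  define Q where "Q n W = (\<Prod>e\<in>{e\<in>E. e \<subseteq> W}. p (card e) n) * (\<Prod>e\<in>{e\<in>D. e \<subseteq> W}. 1 - p (card e) n)" for n W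
  \<comment> \<open>Capping at 1 makes powers of \<open>\<eta>\<close> decreasing, so
    \<open>\<eta> ^ card D\<close> is a lower bound for the non-edge factors inside every
    \<open>W\<close>.\<close>
  define \<eta> where "\<eta> = min \<epsilon> 1"
  have \<eta>: "0 < \<eta>" "\<eta> \<le> 1"
    using \<epsilon>(1) by (auto simp: \<eta>_def)
  have \<eta>p: "\<eta> \<le> 1 - p (card e) n" if "e \<in> D" "n \<ge> 1" for e n
    using \<epsilon>(2)[OF that] by (auto simp: \<eta>_def)
  have H'mem: "H' W \<in> strong_subgraphs H" if "W \<in> Pow V - {{}}" for W
    using that V by (auto simp: strong_subgraphs_def strong_subgraph_def hypergraph_def H'_def V_def E_def
        intro: finite_subset)
  have H'mu: "mu_s p (H' W) n = real n ^ card W * (\<Prod>e\<in>{e\<in>E. e \<subseteq> W}. p (card e) n)"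
    if "W \<in> Pow V - {{}}" for W n
    using H'mem[OF that] V by (subst mu_s_eq_prod) (auto simp: strong_subgraphs_def strong_subgraph_def H'_def)
  \<comment> \<open>The numerator pays for replacing the block size \<open>m\<close> by
    \<open>n\<close>, the denominator for the non-edges.\<close>
  define C where "C W = (2 * real k) ^ card W / \<eta> ^ card D" for W :: "'a set"
  have bound: "1 - (\<Sum>W\<in>Pow V - {{}}. C W * inverse (mu_s p (H' W) n)) \<le> ?P n"
    if n: "n \<ge> k" and mupos: "mu_s p (H' V) n > 0" for n
  proof -
    define m where "m = n div k"
    have m: "m > 0" "card V * m \<le> n" and n1: "n \<ge> 1"
      using n k by (auto simp: m_def div_greater_zero_iff k_def)
    \<comment> \<open>As \<open>m\<close> is at least 1, the remainder is below
      \<open>k * m\<close>; hence the factor 2 in \<open>C\<close>.\<close>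
    have "n = k * m + n mod k" "n mod k < k" "k * 1 \<le> k * m"
      using k m(1) by (auto simp: m_def simp del: mult_1_right)
    then have "n \<le> 2 * k * m" by linarith
    then have nm: "real n \<le> 2 * real k * real m"
      by (metis of_nat_le_iff of_nat_mult of_nat_numeral)
    have c1: "card e \<ge> 1" if "e \<in> Pow V - {{}}" for e
      using that V by (auto simp: Suc_le_eq card_gt_0_iff intro: finite_subset)
    have "{e\<in>E. e \<subseteq> V} = E" using V by auto
    \<comment> \<open>\<open>H' V\<close> is \<open>H\<close> itself, so positivity of its
      \<open>mu_s\<close> makes all edge probabilities positive, as the divisions by
      \<open>Q n W\<close> require.\<close>
    then have "(\<Prod>e\<in>E. p (card e) n) \<noteq> 0"
      using mupos V by (auto simp: H'mu)
    then have ppos: "p (card e) n > 0" if "e \<in> E" for e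
      using that finE p[OF c1 n1, of e] V by (force simp: prod_zero_iff less_le)
    have "1 - (\<Sum>W\<in>Pow V - {{}}. C W * inverse (mu_s p (H' W) n))
        \<le> 1 - (\<Sum>W\<in>Pow V - {{}}. 1 / (real m ^ card W * Q n W))"
    proof (intro diff_left_mono sum_mono)
      fix W assume W: "W \<in> Pow V - {{}}"
      define R where "R = (\<Prod>e\<in>{e\<in>E. e \<subseteq> W}. p (card e) n)"
      have R: "R > 0" unfolding R_def using ppos by (intro prod_pos) auto
      have "\<eta> ^ card D \<le> \<eta> ^ card {e\<in>D. e \<subseteq> W}"
        using \<eta> finD by (intro power_decreasing card_mono) auto
      also have "\<dots> = (\<Prod>e\<in>{e\<in>D. e \<subseteq> W}. \<eta>)" by simp
      also have "\<dots> \<le> (\<Prod>e\<in>{e\<in>D. e \<subseteq> W}. 1 - p (card e) n)"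
        using \<eta> \<eta>p n1 by (intro prod_mono) auto
      finally have Q: "R * \<eta> ^ card D \<le> Q n W"
        using R by (simp add: Q_def R_def[symmetric])
      have "real n ^ card W \<le> (2 * real k * real m) ^ card W"
        using nm by (intro power_mono) auto
      then have "real n ^ card W * (R * \<eta> ^ card D) \<le> ((2 * real k) ^ card W * real m ^ card W) * Q n W"
        using Q R \<eta> by (intro mult_mono) (auto simp: power_mult_distrib)
      moreover have "Q n W > 0" using Q R \<eta> by (smt (verit) mult_pos_pos zero_less_power)
      ultimately show "1 / (real m ^ card W * Q n W) \<le> C W * inverse (mu_s p (H' W) n)"
        using m n1 R \<eta> by (simp add: H'mu[OF W] R_def[symmetric] C_def field_simps)
    qed
    also have "\<dots> \<le> ?P n"
      unfolding V_def[symmetric] E_def[symmetric]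
    proof (rule copy_prob_ge)
      show "p (card e) n < 1" if "e \<in> D" for e
        using \<eta>p[OF that n1] \<eta> by linarith
    qed (use V D p n1 m ppos in \<open>auto simp: Q_def V_def E_def\<close>)
    finally show ?thesis .
  qed
  have "(\<lambda>n. 1 - (\<Sum>W\<in>Pow V - {{}}. C W * inverse (mu_s p (H' W) n)))
      \<longlonglongrightarrow> 1 - (\<Sum>W\<in>Pow V - {{}}. C W * 0)"
    by (intro tendsto_intros tendsto_inverse_0_at_top mu H'mem)
  then have lim: "(\<lambda>n. 1 - (\<Sum>W\<in>Pow V - {{}}. C W * inverse (mu_s p (H' W) n))) \<longlonglongrightarrow> 1"
    by simp
  have "\<forall>\<^sub>F n in sequentially. mu_s p (H' V) n > 0"
    using mu[OF H'mem[of V]] V by (auto simp: filterlim_at_top_dense)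
  then have "\<forall>\<^sub>F n in sequentially. 1 - (\<Sum>W\<in>Pow V - {{}}. C W * inverse (mu_s p (H' W) n)) \<le> ?P n"
    using eventually_ge_at_top[of k] by eventually_elim (use bound in blast)
  then show ?thesis
    by (rule tendsto_sandwich[OF _ _ lim tendsto_const]) simp
qed

section \<open>Isomorphisms, and containment from injections\<close>

text \<open>The inverse of \<open>f\<close> on the vertices also undoes \<open>f\<close> on edges,
  because the edges of \<open>G\<close> lie inside its vertex set.\<close>

lemma hypergraph_iso_sym:
  assumes "hypergraph G" "hypergraph_iso G H"
  shows "hypergraph_iso H G"
proof -
  obtain f where f: "bij_betw f (verts G) (verts H)" "(`) f ` edges G = edges H"
    using assms(2) by (auto simp: hypergraph_iso_def)
  define g where "g = inv_into (verts G) f"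
  have "g ` f ` e = e" if "e \<in> edges G" for e
    using that f(1) assms(1) unfolding g_def
    by (metis PowD bij_betw_def hypergraph_def inv_into_image_cancel subsetD)
  then have "(`) g ` edges H = edges G"
    using f(2) by (force simp: image_image simp flip: f(2))
  then show ?thesis
    using bij_betw_inv_into[OF f(1)] by (auto simp: hypergraph_iso_def g_def)
qed

lemma hypergraph_isoI:
  assumes "hypergraph H" "inj_on f (verts H)"
  shows "hypergraph_iso (f ` verts H, (`) f ` edges H) H"
proof (rule hypergraph_iso_sym[OF assms(1)])
  show "hypergraph_iso H (f ` verts H, (`) f ` edges H)"
    using assms(2) by (auto simp: hypergraph_iso_def bij_betw_def)
qed

lemma contains_induced_imp_contains:
  assumes "hypergraph G" "contains_induced_strong G H"
  shows "contains_strong G H"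
proof -
  obtain W where "W \<subseteq> verts G" "hypergraph_iso (induced_strong_subgraph G W) H"
    using assms(2) by (auto simp: contains_induced_strong_def)
  moreover have "strong_subgraph (induced_strong_subgraph G W) G"
    using assms(1) \<open>W \<subseteq> verts G\<close>
    by (auto simp: strong_subgraph_def induced_strong_subgraph_def hypergraph_def finite_subset)
  ultimately show ?thesis unfolding contains_strong_def by blast
qed

lemma hypergraph_edge_hypergraph: "hypergraph (edge_hypergraph n X)"
  by (auto simp: hypergraph_def edge_hypergraph_def)

lemma copy_imp_contains:
  assumes H: "hypergraph H" "{} \<notin> edges H"
    and f: "inj_on f (verts H)" "f ` verts H \<subseteq> {1..n}" "\<forall>e\<in>edges H. X (f ` e)"
  shows "contains_strong (edge_hypergraph n X) H"
proof -
  have "strong_subgraph (f ` verts H, (`) f ` edges H) (edge_hypergraph n X)"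
    using H f by (fastforce simp: strong_subgraph_def hypergraph_def edge_hypergraph_def)
  then show ?thesis
    using hypergraph_isoI[OF H(1) f(1)] by (auto simp: contains_strong_def)
qed

lemma copy_imp_contains_induced:
  assumes H: "hypergraph H" "{} \<notin> edges H"
    and f: "inj_on f (verts H)" "f ` verts H \<subseteq> {1..n}" "\<forall>e\<in>edges H. X (f ` e)"
      "\<forall>e\<in>Pow (verts H) - {{}} - edges H. \<not> X (f ` e)"
  shows "contains_induced_strong (edge_hypergraph n X) H"
proof -
  have "{e \<in> edges (edge_hypergraph n X). e \<subseteq> f ` verts H} = (`) f ` edges H"
  proof (intro equalityI subsetI)
    fix e assume "e \<in> {e \<in> edges (edge_hypergraph n X). e \<subseteq> f ` verts H}"
    then have e: "X e" "e \<noteq> {}" "e \<subseteq> f ` verts H" by (auto simp: edge_hypergraph_def)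
    then obtain d where d: "d \<subseteq> verts H" "e = f ` d" by (auto simp: subset_image_iff)
    then have "d \<in> edges H" using e f(4) by blast
    then show "e \<in> (`) f ` edges H" using d by blast
  next
    fix e assume "e \<in> (`) f ` edges H"
    then obtain d where d: "d \<in> edges H" "e = f ` d" by blast
    moreover have "d \<subseteq> verts H" "d \<noteq> {}" using H d by (auto simp: hypergraph_def)
    ultimately show "e \<in> {e \<in> edges (edge_hypergraph n X). e \<subseteq> f ` verts H}"
      using f by (auto simp: edge_hypergraph_def)
  qed
  then have "hypergraph_iso (induced_strong_subgraph (edge_hypergraph n X) (f ` verts H)) H"
    using hypergraph_isoI[OF H(1) f(1)] by (simp add: induced_strong_subgraph_def)
  then show ?thesis
    using f(2) by (auto simp: contains_induced_strong_def edge_hypergraph_def)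
qed

section \<open>The first moment bound\<close>

text \<open>A union bound over the injections of \<open>verts H'\<close> into \<open>{1..n}\<close>,
  of which there are at most \<open>n ^ card (verts H')\<close>; a copy of \<open>H\<close>
  restricts to a copy of \<open>H'\<close>.\<close>

lemma prob_contains_le_mu_s:
  assumes H: "hypergraph H" "{} \<notin> edges H" and H': "strong_subgraph H' H"
    and p: "\<And>r. r \<ge> 1 \<Longrightarrow> 0 \<le> p r n \<and> p r n \<le> 1"
  shows "measure_pmf.prob (random_hypergraph n (\<lambda>r. p r n)) {G. contains_strong G H} \<le> mu_s p H' n"
proof -
  let ?M = "random_edges n (\<lambda>r. p r n)"
  define V where "V = verts H'"
  define I where "I = {f \<in> PiE V (\<lambda>_. {1..n}). inj_on f V}"
  \<comment> \<open>The vacuous second conjunct gives the event the shape of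
    \<open>prob_Pi_pmf_bernoulli\<close> with \<open>T\<close> empty.\<close>
  define F where "F f = {X :: nat set \<Rightarrow> bool. (\<forall>e\<in>(`) f ` edges H'. X e) \<and> (\<forall>e\<in>({} :: nat set set). \<not> X e)}"
    for f :: "'a \<Rightarrow> nat"
  have V: "finite V" "edges H' \<subseteq> Pow V" "V \<subseteq> verts H" "edges H' \<subseteq> edges H" "{} \<notin> edges H'"
    "hypergraph H'"
    using H' H by (auto simp: strong_subgraph_def V_def hypergraph_def)
  have finI: "finite I" using V by (simp add: I_def finite_PiE)
  have cardI: "card I \<le> n ^ card V"
  proof -
    have "card I \<le> card (PiE V (\<lambda>_. {1..n}))"
      using V by (intro card_mono) (auto simp: I_def finite_PiE)
    then show ?thesis using V by (simp add: card_PiE)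
  qed
  have sub: "edge_hypergraph n -` {G. contains_strong G H} \<subseteq> (\<Union>f\<in>I. F f)"
  proof
    fix X assume "X \<in> edge_hypergraph n -` {G. contains_strong G H}"
    then obtain G' where G': "strong_subgraph G' (edge_hypergraph n X)" "hypergraph_iso G' H"
      by (auto simp: contains_strong_def)
    then have "hypergraph_iso H G'"
      using hypergraph_iso_sym unfolding strong_subgraph_def by blast
    then obtain f where f: "bij_betw f (verts H) (verts G')" "(`) f ` edges H = edges G'"
      by (auto simp: hypergraph_iso_def)
    \<comment> \<open>Members of \<open>I\<close> are extensional on \<open>V\<close>, which keeps
      \<open>I\<close> finite, so \<open>f\<close> is cut down to \<open>V\<close>.\<close>
    define g where "g = restrict f V"
    have "verts G' \<subseteq> {1..n}" "edges G' \<subseteq> {e. X e}"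
      using G'(1) by (auto simp: strong_subgraph_def edge_hypergraph_def)
    have "g \<in> I"
    proof -
      have "inj_on f V" "f ` V \<subseteq> {1..n}"
        using f(1) V(3) \<open>verts G' \<subseteq> {1..n}\<close> by (auto simp: bij_betw_def intro: inj_on_subset)
      then show ?thesis by (simp add: I_def g_def inj_on_restrict_eq image_subset_iff)
    qed
    moreover have "X \<in> F g"
    proof -
      have "X (g ` e)" if e: "e \<in> edges H'" for e
      proof -
        have "g ` e = f ` e" using e V(2) by (intro image_cong) (auto simp: g_def)
        moreover have "f ` e \<in> edges G'" using e V(4) by (auto simp flip: f(2))
        ultimately show ?thesis using \<open>edges G' \<subseteq> {e. X e}\<close> by auto
      qed
      then show ?thesis by (simp add: F_def)
    qed
    ultimately show "X \<in> (\<Union>f\<in>I. F f)" by blast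
  qed
  have PF: "measure_pmf.prob ?M (F f) = (\<Prod>e\<in>edges H'. p (card e) n)" if f: "f \<in> I" for f
  proof -
    have "measure_pmf.prob ?M (F f) = (\<Prod>e\<in>(`) f ` edges H'. p (card e) n) * (\<Prod>e\<in>({} :: nat set set). 1 - p (card e) n)"
      unfolding random_edges_def F_def
    proof (rule prob_Pi_pmf_bernoulli)
      show "(`) f ` edges H' \<subseteq> Pow {1..n} - {{}}"
      proof (rule image_subsetI)
        fix e assume "e \<in> edges H'"
        then have "e \<subseteq> V" "e \<noteq> {}" using V by auto
        then show "f ` e \<in> Pow {1..n} - {{}}"
          using f by (auto simp: I_def)
      qed
      show "0 \<le> p (card e) n \<and> p (card e) n \<le> 1" if "e \<in> Pow {1..n} - {{}}" for e
        using that by (intro p) (auto simp: Suc_le_eq card_gt_0_iff intro: finite_subset)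
    qed auto
    also have "\<dots> = (\<Prod>e\<in>edges H'. p (card e) n)"
      using f V by (simp add: I_def prod_image_edges[where V = V and g = "\<lambda>r. p r n"])
    finally show ?thesis .
  qed
  have pnn: "0 \<le> p (card e) n" if "e \<in> edges H'" for e
    using that V p[of "card e"]
    by (metis One_nat_def PowD Suc_leI card_gt_0_iff finite_subset subsetD)
  have "measure_pmf.prob (random_hypergraph n (\<lambda>r. p r n)) {G. contains_strong G H}
      \<le> measure_pmf.prob ?M (\<Union>f\<in>I. F f)"
    unfolding prob_random_hypergraph using sub by (intro measure_pmf.finite_measure_mono) auto
  also have "\<dots> \<le> (\<Sum>f\<in>I. measure_pmf.prob ?M (F f))"
    using finI by (intro measure_pmf.finite_measure_subadditive_finite) auto
  also have "\<dots> = real (card I) * (\<Prod>e\<in>edges H'. p (card e) n)"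
    by (simp add: PF)
  also have "\<dots> \<le> real n ^ card V * (\<Prod>e\<in>edges H'. p (card e) n)"
    using cardI pnn by (intro mult_right_mono prod_nonneg) (auto simp flip: of_nat_power)
  also have "\<dots> = mu_s p H' n"
    using V by (simp add: mu_s_eq_prod V_def)
  finally show ?thesis .
qed

lemma aas_not_contains:
  assumes H: "hypergraph H" "{} \<notin> edges H" and H': "H' \<in> strong_subgraphs H"
    and p: "\<And>r n. r \<ge> 1 \<Longrightarrow> n \<ge> 1 \<Longrightarrow> 0 \<le> p r n \<and> p r n \<le> 1"
    and mu: "mu_s p H' \<longlonglongrightarrow> 0"
  shows "aas (\<lambda>n. random_hypergraph n (\<lambda>r. p r n)) (\<lambda>G. \<not> contains_strong G H)"
proof -
  let ?M = "\<lambda>n. random_hypergraph n (\<lambda>r. p r n)"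
  have "\<forall>\<^sub>F n in sequentially. measure_pmf.prob (?M n) {G. contains_strong G H} \<le> mu_s p H' n"
    \<comment> \<open>The bounds on \<open>p\<close> are assumed from \<open>n = 1\<close> on
      only.\<close>
    using eventually_ge_at_top[of 1]
    by eventually_elim (use H H' p in \<open>auto intro!: prob_contains_le_mu_s simp: strong_subgraphs_def\<close>)
  then have "(\<lambda>n. measure_pmf.prob (?M n) {G. contains_strong G H}) \<longlonglongrightarrow> 0"
    by (intro tendsto_sandwich[OF _ _ tendsto_const mu]) auto
  then have "(\<lambda>n. 1 - measure_pmf.prob (?M n) {G. contains_strong G H}) \<longlonglongrightarrow> 1 - 0"
    by (intro tendsto_intros)
  moreover have "1 - measure_pmf.prob (?M n) {G. contains_strong G H}
      = measure_pmf.prob (?M n) {G. \<not> contains_strong G H}" for n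
    using measure_pmf.prob_compl[of "{G. contains_strong G H}" "?M n"]
    by (simp add: Compl_eq_Diff_UNIV[symmetric] Collect_neg_eq)
  ultimately show ?thesis by (simp add: aas_def)
qed

section \<open>Passing the limits to random hypergraphs\<close>

text \<open>Inclusion is asked on the support only: comparing induced with plain containment uses
  \<open>hypergraph G\<close>, which holds for the outcomes of \<open>random_hypergraph\<close> but
  not for every pair.\<close>

lemma tendsto_prob_mono:
  assumes "(\<lambda>n. measure_pmf.prob (M n) (A n)) \<longlonglongrightarrow> 1" "\<And>n. A n \<inter> set_pmf (M n) \<subseteq> B n"
  shows "(\<lambda>n. measure_pmf.prob (M n) (B n)) \<longlonglongrightarrow> 1"
proof (rule tendsto_sandwich[OF _ _ assms(1) tendsto_const])
  show "\<forall>\<^sub>F n in sequentially. measure_pmf.prob (M n) (A n) \<le> measure_pmf.prob (M n) (B n)"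
  proof (intro always_eventually allI)
    fix n
    have "measure_pmf.prob (M n) (A n) = measure_pmf.prob (M n) (A n \<inter> set_pmf (M n))"
      by (simp add: measure_Int_set_pmf)
    also have "\<dots> \<le> measure_pmf.prob (M n) (B n)"
      using assms(2) by (intro measure_pmf.finite_measure_mono) auto
    finally show "measure_pmf.prob (M n) (A n) \<le> measure_pmf.prob (M n) (B n)" .
  qed
qed simp

theorem theorem3p2:
  fixes H :: "'a hypergraph" and p :: "nat \<Rightarrow> nat \<Rightarrow> real"
  assumes "hypergraph H" and "verts H \<noteq> {}" and "{} \<notin> edges H"
    and "\<And>r n. r \<ge> 1 \<Longrightarrow> n \<ge> 1 \<Longrightarrow> 0 \<le> p r n \<and> p r n \<le> 1"
  shows
    "((\<exists>H' \<in> strong_subgraphs H. mu_s p H' \<longlonglongrightarrow> 0) \<longrightarrow>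
        aas (\<lambda>n. random_hypergraph n (\<lambda>r. p r n)) (\<lambda>G. \<not> contains_strong G H)) \<and>
     ((\<forall>H' \<in> strong_subgraphs H. filterlim (mu_s p H') at_top sequentially) \<longrightarrow>
        aas (\<lambda>n. random_hypergraph n (\<lambda>r. p r n)) (\<lambda>G. contains_strong G H)) \<and>
     ((\<exists>\<epsilon>>0. \<forall>r\<ge>1. \<forall>n\<ge>1. p r n \<le> 1 - \<epsilon>) \<longrightarrow>
        ((\<exists>H' \<in> strong_subgraphs H. mu_s p H' \<longlonglongrightarrow> 0) \<longrightarrow>
           aas (\<lambda>n. random_hypergraph n (\<lambda>r. p r n)) (\<lambda>G. \<not> contains_induced_strong G H)) \<and>
        ((\<forall>H' \<in> strong_subgraphs H. filterlim (mu_s p H') at_top sequentially) \<longrightarrow>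
           aas (\<lambda>n. random_hypergraph n (\<lambda>r. p r n)) (\<lambda>G. contains_induced_strong G H)))"
proof (intro conjI impI)
  assume "\<exists>H' \<in> strong_subgraphs H. mu_s p H' \<longlonglongrightarrow> 0"
  then show a: "aas (\<lambda>n. random_hypergraph n (\<lambda>r. p r n)) (\<lambda>G. \<not> contains_strong G H)"
    using aas_not_contains assms(1,3,4) by blast
  show "aas (\<lambda>n. random_hypergraph n (\<lambda>r. p r n)) (\<lambda>G. \<not> contains_induced_strong G H)"
    unfolding aas_def
  proof (rule tendsto_prob_mono[OF a[unfolded aas_def]])
    have "hypergraph G" if "G \<in> set_pmf (random_hypergraph n (\<lambda>r. p r n))" for G n
      using that hypergraph_edge_hypergraph[of n]
      by (auto simp: random_hypergraph_def edge_hypergraph_def)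
    then show "{G. \<not> contains_strong G H} \<inter> set_pmf (random_hypergraph n (\<lambda>r. p r n))
        \<subseteq> {G. \<not> contains_induced_strong G H}" for n
      using contains_induced_imp_contains by blast
  qed
next
  assume "\<forall>H' \<in> strong_subgraphs H. filterlim (mu_s p H') at_top sequentially"
  then have "(\<lambda>n. measure_pmf.prob (random_edges n (\<lambda>r. p r n))
      {X. \<exists>f. inj_on f (verts H) \<and> f ` verts H \<subseteq> {1..n} \<and>
              (\<forall>e\<in>edges H. X (f ` e)) \<and> (\<forall>e\<in>{}. \<not> X (f ` e))}) \<longlonglongrightarrow> 1"
    \<comment> \<open>With no prescribed non-edges the condition on \<open>\<epsilon>\<close> is
      vacuous, so any positive value serves.\<close>
    by (intro copy_prob_tendsto_1[where \<epsilon> = 1]) (use assms in auto)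
  then show "aas (\<lambda>n. random_hypergraph n (\<lambda>r. p r n)) (\<lambda>G. contains_strong G H)"
    unfolding aas_def prob_random_hypergraph
    by (rule tendsto_prob_mono) (use copy_imp_contains[OF assms(1,3)] in auto)
next
  assume "\<exists>\<epsilon>>0. \<forall>r\<ge>1. \<forall>n\<ge>1. p r n \<le> 1 - \<epsilon>"
  then obtain \<epsilon> where \<epsilon>: "\<epsilon> > 0" "\<And>r n. r \<ge> 1 \<Longrightarrow> n \<ge> 1 \<Longrightarrow> p r n \<le> 1 - \<epsilon>" by blast
  assume mu: "\<forall>H' \<in> strong_subgraphs H. filterlim (mu_s p H') at_top sequentially"
  \<comment> \<open>The bound \<open>1 - \<epsilon>\<close> is available for sizes
    \<open>r \<ge> 1\<close>, which covers every prescribed non-edge.\<close>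
  have "card e \<ge> 1" if "e \<in> Pow (verts H) - {{}} - edges H" for e
    using that assms(1) by (auto simp: Suc_le_eq card_gt_0_iff hypergraph_def intro: finite_subset)
  then have "(\<lambda>n. measure_pmf.prob (random_edges n (\<lambda>r. p r n))
      {X. \<exists>f. inj_on f (verts H) \<and> f ` verts H \<subseteq> {1..n} \<and>
              (\<forall>e\<in>edges H. X (f ` e)) \<and> (\<forall>e\<in>Pow (verts H) - {{}} - edges H. \<not> X (f ` e))}) \<longlonglongrightarrow> 1"
    by (intro copy_prob_tendsto_1[where \<epsilon> = \<epsilon>]) (use assms \<epsilon> mu in auto)
  then show "aas (\<lambda>n. random_hypergraph n (\<lambda>r. p r n)) (\<lambda>G. contains_induced_strong G H)"
    unfolding aas_def prob_random_hypergraph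
    by (rule tendsto_prob_mono) (use copy_imp_contains_induced[OF assms(1,3)] in auto)
qed

end
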